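(* Let $\mathbf{C}$ and $\mathbf{D}$ be dagger categories and let $F\colon\mathbf{C}\to\mathbf{D}$, $G\colon\mathbf{D}\to\mathbf{C}$ form a dagger adjunction $F\dashv G$. Then $G\circ F$, with the monad structure induced by the adjunction, is a dagger Frobenius monad on $\mathbf{C}$.
   Context: A dagger on a category $\mathbf{D}$ is a functor $\dagger\colon\mathbf{D}^{\mathrm{op}}\to\mathbf{D}$ with $A^\dagger=A$ on objects and $f^{\dagger\dagger}=f$ on morphisms; a dagger category is a category with a chosen dagger. A dagger functor is a functor $F$ between dagger categories with $F(f^\dagger)=F(f)^\dagger$. A dagger adjunction is an adjunction between dagger categories in which both functors are dagger functors. A dagger Frobenius monad on a dagger category $\mathbf{C}$ is a monad $(T,\mu,\eta)$ on $\mathbf{C}$ such that $T(f^\dagger)=T(f)^\dagger$ for all morphisms $f$ and, for every object $A$, $T(\mu_A)\circ\mu_{T(A)}^\dagger=\mu_{T(A)}\circ T(\mu_A^\dagger)$. *)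

theory Defs
  imports Main
begin

text \<open>
  Categories are carrier-based, so objects and arrows range over sets. Functors and families of
  components are total HOL functions, constrained only on those carriers.
  \<open>Comp C g f\<close> is the composite "g after f".
\<close>

record ('o, 'm) category =
  Ob :: "'o set"
  Arr :: "'m set"
  Dom :: "'m \<Rightarrow> 'o"
  Cod :: "'m \<Rightarrow> 'o"
  Id :: "'o \<Rightarrow> 'm"
  Comp :: "'m \<Rightarrow> 'm \<Rightarrow> 'm"  (infixr "\<cdot>\<index>" 70)

definition Hom :: "('o, 'm, 'e) category_scheme \<Rightarrow> 'o \<Rightarrow> 'o \<Rightarrow> 'm set" where
  "Hom C A B = {f \<in> Arr C. Dom C f = A \<and> Cod C f = B}"

locale category =
  fixes C :: "('o, 'm, 'e) category_scheme" (structure)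
  assumes Dom_in_Ob: "f \<in> Arr C \<Longrightarrow> Dom C f \<in> Ob C"
    and Cod_in_Ob: "f \<in> Arr C \<Longrightarrow> Cod C f \<in> Ob C"
    and Id_in_Hom: "A \<in> Ob C \<Longrightarrow> Id C A \<in> Hom C A A"
    and Comp_in_Hom: "f \<in> Hom C X Y \<Longrightarrow> g \<in> Hom C Y Z \<Longrightarrow> g \<cdot> f \<in> Hom C X Z"
    and Comp_Id: "f \<in> Hom C X Y \<Longrightarrow> f \<cdot> Id C X = f"
    and Id_Comp: "f \<in> Hom C X Y \<Longrightarrow> Id C Y \<cdot> f = f"
    and Comp_assoc:
      "f \<in> Hom C W X \<Longrightarrow> g \<in> Hom C X Y \<Longrightarrow> h \<in> Hom C Y Z \<Longrightarrow> (h \<cdot> g) \<cdot> f = h \<cdot> (g \<cdot> f)"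

definition opposite :: "('o, 'm, 'e) category_scheme \<Rightarrow> ('o, 'm) category" where
  "opposite C = \<lparr>Ob = Ob C, Arr = Arr C, Dom = Cod C, Cod = Dom C, Id = Id C,
     Comp = (\<lambda>g f. Comp C f g)\<rparr>"

record ('o, 'm, 'p, 'n) functor_maps =
  Obj_map :: "'o \<Rightarrow> 'p"
  Arr_map :: "'m \<Rightarrow> 'n"

locale cat_functor = source: category C + target: category D
  for C :: "('o, 'm, 'e) category_scheme"
    and D :: "('p, 'n, 'd) category_scheme"
    and F :: "('o, 'm, 'p, 'n) functor_maps" +
  assumes Obj_map_in_Ob: "A \<in> Ob C \<Longrightarrow> Obj_map F A \<in> Ob D"
    and Arr_map_in_Hom: "f \<in> Hom C A B \<Longrightarrow> Arr_map F f \<in> Hom D (Obj_map F A) (Obj_map F B)"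
    and Arr_map_Id: "A \<in> Ob C \<Longrightarrow> Arr_map F (Id C A) = Id D (Obj_map F A)"
    and Arr_map_Comp: "f \<in> Hom C X Y \<Longrightarrow> g \<in> Hom C Y Z \<Longrightarrow>
      Arr_map F (g \<cdot>\<^bsub>C\<^esub> f) = Arr_map F g \<cdot>\<^bsub>D\<^esub> Arr_map F f"

definition Id_functor :: "('o, 'm, 'o, 'm) functor_maps" where
  "Id_functor = \<lparr>Obj_map = (\<lambda>A. A), Arr_map = (\<lambda>f. f)\<rparr>"

definition functor_comp ::
  "('p, 'n, 'q, 'k) functor_maps \<Rightarrow> ('o, 'm, 'p, 'n) functor_maps \<Rightarrow> ('o, 'm, 'q, 'k) functor_maps"
  (infixr "\<circ>\<circ>" 75) where
  "G \<circ>\<circ> F = \<lparr>Obj_map = (\<lambda>A. Obj_map G (Obj_map F A)), Arr_map = (\<lambda>f. Arr_map G (Arr_map F f))\<rparr>"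

locale natural_transformation = source_functor: cat_functor C D F + target_functor: cat_functor C D G
  for C :: "('o, 'm, 'e) category_scheme"
    and D :: "('p, 'n, 'd) category_scheme"
    and F G :: "('o, 'm, 'p, 'n) functor_maps"
    and \<tau> :: "'o \<Rightarrow> 'n" +
  assumes component_in_Hom: "A \<in> Ob C \<Longrightarrow> \<tau> A \<in> Hom D (Obj_map F A) (Obj_map G A)"
    and naturality: "f \<in> Hom C A B \<Longrightarrow> \<tau> B \<cdot>\<^bsub>D\<^esub> Arr_map F f = Arr_map G f \<cdot>\<^bsub>D\<^esub> \<tau> A"

locale adjunction =
  left_adjoint: cat_functor C D F + right_adjoint: cat_functor D C G +
  unit: natural_transformation C C Id_functor "G \<circ>\<circ> F" \<eta> +
  counit: natural_transformation D D "F \<circ>\<circ> G" Id_functor \<epsilon>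
  for C :: "('o, 'm, 'e) category_scheme"
    and D :: "('p, 'n, 'd) category_scheme"
    and F :: "('o, 'm, 'p, 'n) functor_maps"
    and G :: "('p, 'n, 'o, 'm) functor_maps"
    and \<eta> :: "'o \<Rightarrow> 'm"
    and \<epsilon> :: "'p \<Rightarrow> 'n" +
  assumes triangle_left: "A \<in> Ob C \<Longrightarrow>
      \<epsilon> (Obj_map F A) \<cdot>\<^bsub>D\<^esub> Arr_map F (\<eta> A) = Id D (Obj_map F A)"
    and triangle_right: "B \<in> Ob D \<Longrightarrow>
      Arr_map G (\<epsilon> B) \<cdot>\<^bsub>C\<^esub> \<eta> (Obj_map G B) = Id C (Obj_map G B)"

locale cat_monad =
  endofunctor: cat_functor C C T +
  multiplication: natural_transformation C C "T \<circ>\<circ> T" T \<mu> +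
  unit: natural_transformation C C Id_functor T \<eta>
  for C :: "('o, 'm, 'e) category_scheme" (structure)
    and T :: "('o, 'm, 'o, 'm) functor_maps"
    and \<mu> :: "'o \<Rightarrow> 'm"
    and \<eta> :: "'o \<Rightarrow> 'm" +
  assumes mult_assoc: "A \<in> Ob C \<Longrightarrow> \<mu> A \<cdot> Arr_map T (\<mu> A) = \<mu> A \<cdot> \<mu> (Obj_map T A)"
    and mult_unit_left: "A \<in> Ob C \<Longrightarrow> \<mu> A \<cdot> \<eta> (Obj_map T A) = Id C (Obj_map T A)"
    and mult_unit_right: "A \<in> Ob C \<Longrightarrow> \<mu> A \<cdot> Arr_map T (\<eta> A) = Id C (Obj_map T A)"

text \<open>The multiplication of the monad induced by an adjunction, with components
  \<open>G (\<epsilon> (F A))\<close>; its functor is \<open>G \<circ>\<circ> F\<close> and its unit is the unit of the adjunction.\<close>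

definition induced_mult ::
  "('o, 'm, 'p, 'n) functor_maps \<Rightarrow> ('p, 'n, 'o, 'm) functor_maps \<Rightarrow> ('p \<Rightarrow> 'n) \<Rightarrow> 'o \<Rightarrow> 'm" where
  "induced_mult F G \<epsilon> A = Arr_map G (\<epsilon> (Obj_map F A))"

record ('o, 'm) dagger_category = "('o, 'm) category" +
  dagger :: "'m \<Rightarrow> 'm"  ("_\<^sup>\<dagger>\<index>" [1000] 999)

locale dagger_category = category C
  for C :: "('o, 'm, 'e) dagger_category_scheme" (structure) +
  assumes dagger_functor:
      "cat_functor (opposite C) C \<lparr>Obj_map = (\<lambda>A. A), Arr_map = dagger C\<rparr>"
    and dagger_dagger: "f \<in> Arr C \<Longrightarrow> (f\<^sup>\<dagger>)\<^sup>\<dagger> = f"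

locale dagger_functor =
  source: dagger_category C + target: dagger_category D + cat_functor C D F
  for C :: "('o, 'm, 'e) dagger_category_scheme"
    and D :: "('p, 'n, 'd) dagger_category_scheme"
    and F :: "('o, 'm, 'p, 'n) functor_maps" +
  assumes Arr_map_dagger: "f \<in> Arr C \<Longrightarrow> Arr_map F (f\<^sup>\<dagger>\<^bsub>C\<^esub>) = (Arr_map F f)\<^sup>\<dagger>\<^bsub>D\<^esub>"

locale dagger_adjunction =
  adjunction C D F G \<eta> \<epsilon> + left_adjoint: dagger_functor C D F + right_adjoint: dagger_functor D C G
  for C :: "('o, 'm, 'e) dagger_category_scheme"
    and D :: "('p, 'n, 'd) dagger_category_scheme"
    and F :: "('o, 'm, 'p, 'n) functor_maps"
    and G :: "('p, 'n, 'o, 'm) functor_maps"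
    and \<eta> :: "'o \<Rightarrow> 'm"
    and \<epsilon> :: "'p \<Rightarrow> 'n"

locale dagger_frobenius_monad =
  dagger_category C + cat_monad C T \<mu> \<eta>
  for C :: "('o, 'm, 'e) dagger_category_scheme" (structure)
    and T :: "('o, 'm, 'o, 'm) functor_maps"
    and \<mu> :: "'o \<Rightarrow> 'm"
    and \<eta> :: "'o \<Rightarrow> 'm" +
  assumes Arr_map_dagger: "f \<in> Arr C \<Longrightarrow> Arr_map T (f\<^sup>\<dagger>) = (Arr_map T f)\<^sup>\<dagger>"
    and frobenius_law: "A \<in> Ob C \<Longrightarrow>
      Arr_map T (\<mu> A) \<cdot> (\<mu> (Obj_map T A))\<^sup>\<dagger> = \<mu> (Obj_map T A) \<cdot> Arr_map T ((\<mu> A)\<^sup>\<dagger>)"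

end

theory Submission
  imports Defs
begin

text \<open>
  Naturality of the counit at the arrow \<open>(\<epsilon>\<^bsub>F A\<^esub>)\<^sup>\<dagger>\<close> turns the right-hand side of the Frobenius
  law into \<open>G ((\<epsilon>\<^bsub>F A\<^esub>)\<^sup>\<dagger> \<epsilon>\<^bsub>F A\<^esub>)\<close>. The left-hand side is the dagger of the right-hand
  side, and this arrow is self-adjoint.
\<close>

lemma Obj_map_functor_comp [simp]: "Obj_map (G \<circ>\<circ> F) A = Obj_map G (Obj_map F A)"
  and Arr_map_functor_comp [simp]: "Arr_map (G \<circ>\<circ> F) f = Arr_map G (Arr_map F f)"
  by (simp_all add: functor_comp_def)

lemma Obj_map_Id_functor [simp]: "Obj_map Id_functor A = A"
  and Arr_map_Id_functor [simp]: "Arr_map Id_functor f = f"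
  by (simp_all add: Id_functor_def)

lemma Hom_in_Arr: "f \<in> Hom C A B \<Longrightarrow> f \<in> Arr C"
  by (simp add: Hom_def)

lemma Hom_opposite [simp]: "Hom (opposite C) A B = Hom C B A"
  by (auto simp: Hom_def opposite_def)

lemma Comp_opposite [simp]: "Comp (opposite C) g f = Comp C f g"
  by (simp add: opposite_def)

lemma cat_functor_comp:
  assumes "cat_functor A B F" and "cat_functor B C G"
  shows "cat_functor A C (G \<circ>\<circ> F)"
proof -
  interpret F: cat_functor A B F by fact
  interpret G: cat_functor B C G by fact
  show ?thesis
    by unfold_locales
      (auto intro: F.Obj_map_in_Ob G.Obj_map_in_Ob F.Arr_map_in_Hom G.Arr_map_in_Hom
        simp: F.Arr_map_Id G.Arr_map_Id [OF F.Obj_map_in_Ob] F.Arr_map_Comp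
          G.Arr_map_Comp [OF F.Arr_map_in_Hom F.Arr_map_in_Hom])
qed

context dagger_category
begin

lemma dagger_in_Hom: "f \<in> Hom C A B \<Longrightarrow> f\<^sup>\<dagger> \<in> Hom C B A"
  using cat_functor.Arr_map_in_Hom [OF dagger_functor, of f B A] by simp

lemma dagger_Comp:
  "f \<in> Hom C X Y \<Longrightarrow> g \<in> Hom C Y Z \<Longrightarrow> (g \<cdot> f)\<^sup>\<dagger> = f\<^sup>\<dagger> \<cdot> g\<^sup>\<dagger>"
  \<comment> \<open>In the opposite category \<open>g\<close> runs from \<open>Z\<close> to
    \<open>Y\<close> and is followed by \<open>f\<close> from \<open>Y\<close> to \<open>X\<close>,
    hence the swapped instantiation.\<close>
  using cat_functor.Arr_map_Comp [OF dagger_functor, of g Z Y f X] by simp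

lemma dagger_Comp_self_adjoint:
  assumes "f \<in> Hom C X Y"
  shows "(f\<^sup>\<dagger> \<cdot> f)\<^sup>\<dagger> = f\<^sup>\<dagger> \<cdot> f"
  using dagger_Comp [OF assms dagger_in_Hom [OF assms]] dagger_dagger [OF Hom_in_Arr [OF assms]]
  by simp

end

context adjunction
begin

lemma counit_in_Hom:
  "B \<in> Ob D \<Longrightarrow> \<epsilon> B \<in> Hom D (Obj_map F (Obj_map G B)) B"
  using counit.component_in_Hom [of B] by simp

lemma counit_naturality:
  "f \<in> Hom D A B \<Longrightarrow> \<epsilon> B \<cdot>\<^bsub>D\<^esub> Arr_map F (Arr_map G f) = f \<cdot>\<^bsub>D\<^esub> \<epsilon> A"
  using counit.naturality [of f A B] by simp

text \<open>This is the image under \<open>G\<close> of the naturality square of the counit.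
  Different choices of \<open>f\<close> yield associativity and naturality of the induced
  multiplication, and later the Frobenius law.\<close>

lemma right_adjoint_counit_naturality:
  assumes "f \<in> Hom D A B"
  shows "Arr_map G (\<epsilon> B) \<cdot>\<^bsub>C\<^esub> Arr_map G (Arr_map F (Arr_map G f))
    = Arr_map G f \<cdot>\<^bsub>C\<^esub> Arr_map G (\<epsilon> A)"
proof -
  have A: "A \<in> Ob D" and B: "B \<in> Ob D"
    using assms left_adjoint.target.Dom_in_Ob left_adjoint.target.Cod_in_Ob
    by (auto simp: Hom_def)
  have "Arr_map F (Arr_map G f)
      \<in> Hom D (Obj_map F (Obj_map G A)) (Obj_map F (Obj_map G B))"
    using assms by (intro left_adjoint.Arr_map_in_Hom right_adjoint.Arr_map_in_Hom)
  from right_adjoint.Arr_map_Comp [OF this counit_in_Hom [OF B]] show ?thesis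
    using right_adjoint.Arr_map_Comp [OF counit_in_Hom [OF A] assms] counit_naturality [OF assms]
    by simp
qed

theorem induced_monad: "cat_monad C (G \<circ>\<circ> F) (induced_mult F G \<epsilon>) \<eta>"
proof -
  \<comment> \<open>The multiplication is a natural transformation out of the square of the
    endofunctor, so that square must itself be known to be a functor.\<close>
  interpret TT: cat_functor C C "(G \<circ>\<circ> F) \<circ>\<circ> G \<circ>\<circ> F"
    using unit.target_functor.cat_functor_axioms unit.target_functor.cat_functor_axioms
    by (rule cat_functor_comp)
  show ?thesis
  \<comment> \<open>Functoriality of \<open>G \<circ>\<circ> F\<close> and naturality of
    \<open>\<eta>\<close> come with the adjunction; only goals involving the multiplication
    remain.\<close>
  proof unfold_locales
    fix A
    assume A: "A \<in> Ob C"
    let ?e = "\<epsilon> (Obj_map F A)"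
    have FA: "Obj_map F A \<in> Ob D"
      using A by (rule left_adjoint.Obj_map_in_Ob)
    have e: "?e \<in> Hom D (Obj_map F (Obj_map G (Obj_map F A))) (Obj_map F A)"
      using FA by (rule counit_in_Hom)
    show "induced_mult F G \<epsilon> A
        \<in> Hom C (Obj_map ((G \<circ>\<circ> F) \<circ>\<circ> G \<circ>\<circ> F) A) (Obj_map (G \<circ>\<circ> F) A)"
      using right_adjoint.Arr_map_in_Hom [OF e] by (simp add: induced_mult_def)
    \<comment> \<open>Associativity is naturality of the counit at the arrow \<open>?e\<close>,
      itself a counit component.\<close>
    show "induced_mult F G \<epsilon> A \<cdot>\<^bsub>C\<^esub> Arr_map (G \<circ>\<circ> F) (induced_mult F G \<epsilon> A)
        = induced_mult F G \<epsilon> A \<cdot>\<^bsub>C\<^esub> induced_mult F G \<epsilon> (Obj_map (G \<circ>\<circ> F) A)"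
      using right_adjoint_counit_naturality [OF e] by (simp add: induced_mult_def)
    \<comment> \<open>One unit law is the right triangle identity at the object
      \<open>Obj_map F A\<close>.\<close>
    show "induced_mult F G \<epsilon> A \<cdot>\<^bsub>C\<^esub> \<eta> (Obj_map (G \<circ>\<circ> F) A) = Id C (Obj_map (G \<circ>\<circ> F) A)"
      using triangle_right [OF FA] by (simp add: induced_mult_def)
    have "\<eta> A \<in> Hom C A (Obj_map G (Obj_map F A))"
      using unit.component_in_Hom [OF A] by simp
    \<comment> \<open>The other unit law is the left triangle identity at \<open>A\<close>,
      transported along \<open>G\<close>.\<close>
    from right_adjoint.Arr_map_Comp [OF left_adjoint.Arr_map_in_Hom [OF this] e]
    show "induced_mult F G \<epsilon> A \<cdot>\<^bsub>C\<^esub> Arr_map (G \<circ>\<circ> F) (\<eta> A) = Id C (Obj_map (G \<circ>\<circ> F) A)"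
      using triangle_left [OF A] right_adjoint.Arr_map_Id [OF FA]
      by (simp add: induced_mult_def)
  next
    fix f A B
    assume "f \<in> Hom C A B"
    \<comment> \<open>Here naturality of the counit is used at \<open>Arr_map F f\<close>.\<close>
    then show "induced_mult F G \<epsilon> B \<cdot>\<^bsub>C\<^esub> Arr_map ((G \<circ>\<circ> F) \<circ>\<circ> G \<circ>\<circ> F) f
        = Arr_map (G \<circ>\<circ> F) f \<cdot>\<^bsub>C\<^esub> induced_mult F G \<epsilon> A"
      using right_adjoint_counit_naturality [OF left_adjoint.Arr_map_in_Hom]
      by (simp add: induced_mult_def)
  qed
qed

end

context dagger_adjunction
begin

lemma functor_comp_dagger:
  assumes "f \<in> Arr C"
  shows "Arr_map (G \<circ>\<circ> F) (f\<^sup>\<dagger>\<^bsub>C\<^esub>) = (Arr_map (G \<circ>\<circ> F) f)\<^sup>\<dagger>\<^bsub>C\<^esub>"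
proof -
  have "Arr_map F f \<in> Arr D"
    using assms left_adjoint.Arr_map_in_Hom [of f "Dom C f" "Cod C f"] by (simp add: Hom_def)
  then show ?thesis
    using assms by (simp add: left_adjoint.Arr_map_dagger right_adjoint.Arr_map_dagger)
qed

lemma induced_mult_frobenius:
  assumes A: "A \<in> Ob C"
  defines "T \<equiv> G \<circ>\<circ> F" and "\<mu> \<equiv> induced_mult F G \<epsilon>"
  shows "Arr_map T (\<mu> A) \<cdot>\<^bsub>C\<^esub> (\<mu> (Obj_map T A))\<^sup>\<dagger>\<^bsub>C\<^esub>
    = \<mu> (Obj_map T A) \<cdot>\<^bsub>C\<^esub> Arr_map T ((\<mu> A)\<^sup>\<dagger>\<^bsub>C\<^esub>)"
proof -
  let ?FA = "Obj_map F A"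
  let ?TA = "Obj_map G ?FA"
  let ?e = "\<epsilon> ?FA"
  \<comment> \<open>With \<open>induced_mult\<close> unfolded, \<open>?m\<close> is
    \<open>\<mu> A\<close> and \<open>?n\<close> is \<open>\<mu> (Obj_map T A)\<close>.\<close>
  let ?m = "Arr_map G ?e"
  let ?n = "Arr_map G (\<epsilon> (Obj_map F ?TA))"
  have FA: "?FA \<in> Ob D"
    using A by (rule left_adjoint.Obj_map_in_Ob)
  have FTA: "Obj_map F ?TA \<in> Ob D"
    using A by (intro left_adjoint.Obj_map_in_Ob right_adjoint.Obj_map_in_Ob)
  have e: "?e \<in> Hom D (Obj_map F ?TA) ?FA"
    using FA by (rule counit_in_Hom)
  have e': "?e\<^sup>\<dagger>\<^bsub>D\<^esub> \<in> Hom D ?FA (Obj_map F ?TA)"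
    using e by (rule left_adjoint.target.dagger_in_Hom)
  have m: "?m \<in> Hom C (Obj_map T ?TA) ?TA"
    using right_adjoint.Arr_map_in_Hom [OF e] by (simp add: T_def)
  have m': "?m\<^sup>\<dagger>\<^bsub>C\<^esub> \<in> Hom C ?TA (Obj_map T ?TA)"
    using m by (rule left_adjoint.source.dagger_in_Hom)
  have Tm': "Arr_map T (?m\<^sup>\<dagger>\<^bsub>C\<^esub>) \<in> Hom C (Obj_map T ?TA) (Obj_map T (Obj_map T ?TA))"
    using right_adjoint.Arr_map_in_Hom [OF left_adjoint.Arr_map_in_Hom [OF m']]
    by (simp add: T_def)
  have n: "?n \<in> Hom C (Obj_map T (Obj_map T ?TA)) (Obj_map T ?TA)"
    using right_adjoint.Arr_map_in_Hom [OF counit_in_Hom [OF FTA]] by (simp add: T_def)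
  \<comment> \<open>Since \<open>G\<close> preserves daggers, \<open>?m\<^sup>\<dagger>\<close> is
    the image of the dagger of \<open>?e\<close>; this puts the naturality square into terms of
    \<open>?m\<close> alone.\<close>
  have rhs: "?n \<cdot>\<^bsub>C\<^esub> Arr_map T (?m\<^sup>\<dagger>\<^bsub>C\<^esub>) = ?m\<^sup>\<dagger>\<^bsub>C\<^esub> \<cdot>\<^bsub>C\<^esub> ?m"
    using right_adjoint_counit_naturality [OF e']
      right_adjoint.Arr_map_dagger [OF Hom_in_Arr [OF e]]
    by (simp add: T_def)
  \<comment> \<open>\<open>T\<close> commutes with the dagger, and the two daggers on
    \<open>?m\<close> cancel.\<close>
  have Tm: "(Arr_map T (?m\<^sup>\<dagger>\<^bsub>C\<^esub>))\<^sup>\<dagger>\<^bsub>C\<^esub> = Arr_map T ?m"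
    using functor_comp_dagger [OF Hom_in_Arr [OF m']]
      left_adjoint.source.dagger_dagger [OF Hom_in_Arr [OF m]]
    by (simp add: T_def)
  have "Arr_map T ?m \<cdot>\<^bsub>C\<^esub> ?n\<^sup>\<dagger>\<^bsub>C\<^esub> = (?n \<cdot>\<^bsub>C\<^esub> Arr_map T (?m\<^sup>\<dagger>\<^bsub>C\<^esub>))\<^sup>\<dagger>\<^bsub>C\<^esub>"
    by (simp add: left_adjoint.source.dagger_Comp [OF Tm' n] Tm)
  \<comment> \<open>By \<open>rhs\<close> the composite has the form
    \<open>f\<^sup>\<dagger> \<cdot> f\<close> with \<open>f\<close> equal to \<open>?m\<close>, so
    the dagger fixes it.\<close>
  also have "\<dots> = ?n \<cdot>\<^bsub>C\<^esub> Arr_map T (?m\<^sup>\<dagger>\<^bsub>C\<^esub>)"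
    using left_adjoint.source.dagger_Comp_self_adjoint [OF m] by (simp add: rhs)
  finally show ?thesis
    by (simp add: \<mu>_def T_def induced_mult_def)
qed

end

theorem lemma5p5:
  fixes C :: "('o, 'm) dagger_category"
    and D :: "('p, 'n) dagger_category"
    and F :: "('o, 'm, 'p, 'n) functor_maps"
    and G :: "('p, 'n, 'o, 'm) functor_maps"
    and \<eta> :: "'o \<Rightarrow> 'm"
    and \<epsilon> :: "'p \<Rightarrow> 'n"
  assumes "dagger_category C"
    and "dagger_category D"
    and "dagger_adjunction C D F G \<eta> \<epsilon>"
  shows "dagger_frobenius_monad C (G \<circ>\<circ> F) (induced_mult F G \<epsilon>) \<eta>"
proof -
  interpret dagger_adjunction C D F G \<eta> \<epsilon>
    by fact
  show ?thesis
    using assms(1) induced_monad functor_comp_dagger induced_mult_frobenius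
    by (intro dagger_frobenius_monad.intro dagger_frobenius_monad_axioms.intro)
qed

end
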